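(* For every integer $k\ge2$, the greedy hitting-set algorithm $\mathcal{A}$ described in the context, run on the input $([\mathrm{len}(I_k)],I_k)$, colors it with $k$ colors; that is, the set of positive colors used by the coloring it outputs is $\{1,\dots,k\}$.
   Context: Notation: $[n]=\{1,\dots,n\}$; for positive integers $s\le t$, $[s,t]=\{s,s+1,\dots,t\}$ is a (discrete) interval. Colors are non-negative integers; color $0$ means "uncolored" and is not counted as a color. For a set of intervals $I$ and a natural number $d$, $I^{+d}=\{[i+d,j+d] : [i,j]\in I\}$. The length $\mathrm{len}(I)$ is the rightmost point occurring in any interval of $I$ minus the leftmost point occurring in any interval of $I$, plus one. Instances $I_k$, $k\ge2$: $I_2=\{[1,2],[3,3],[2,4]\}$ and, for $k\ge 2$, $$I_{k+1}=I_k\cup I_k^{+\mathrm{len}(I_k)}\cup\{[\mathrm{len}(I_k)-k+1,\;2\,\mathrm{len}(I_k)+1]\}.$$ $I_k$ is identified with the hypergraph with vertex set $[\mathrm{len}(I_k)]$ and hyperedge set $I_k$. Algorithm $\mathcal{A}$ on input $([n],I)$, where $I$ is a set of intervals contained in $[n]$: set $\ell=0$, $V^0=[n]$, $\mathcal{E}^0=I$. While $\mathcal{E}^\ell\neq\emptyset$: (1) compute a hitting set $S^\ell\subseteq V^\ell$ greedily: start with $F=\emptyset$; as long as some hyperedge of $\mathcal{E}^\ell$ is disjoint from all members of $F$, add to $F$ such a hyperedge whose maximum element is smallest possible; then let $S^\ell$ be the set of maximum elements of the members of $F$; (2) give every $v\in V^\ell\setminus S^\ell$ the color $\ell$; (3)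 set $V^{\ell+1}=S^\ell$, $\mathcal{E}^{\ell+1}=\{e\cap S^\ell : e\in\mathcal{E}^\ell,\ |e\cap S^\ell|>1\}$, and increase $\ell$ by one. When the loop ends, give every $v\in V^\ell$ (if any) the color $\ell$. *)

theory Defs
  imports Main
begin

text \<open>The interval \<open>[i,j]\<close> is the set \<^term>\<open>{i..j}\<close> of naturals with \<open>1 \<le> i \<le> j\<close>, so a set of
  intervals is directly the hyperedge set of a hypergraph.\<close>

definition shift :: "nat \<Rightarrow> nat set set \<Rightarrow> nat set set" where
  "shift d I = {{i + d..j + d} |i j. i \<le> j \<and> {i..j} \<in> I}"

definition len :: "nat set set \<Rightarrow> nat" where
  "len I = Max (\<Union>I) - Min (\<Union>I) + 1"

text \<open>The instances are meaningful for indices \<open>\<ge> 2\<close> only; the values at \<open>0\<close> and \<open>1\<close> are dummies.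
  The last equation defines the instance with index \<open>k + 1\<close> for \<open>k = m + 2\<close>. The subtraction
  \<open>len J - k\<close> never truncates, as the instance \<open>J\<close> with index \<open>k\<close> has length at least \<open>2 * k\<close>.\<close>

fun inst :: "nat \<Rightarrow> nat set set" where
  "inst 0 = {}"
| "inst (Suc 0) = {}"
| "inst (Suc (Suc 0)) = {{1..2}, {3..3}, {2..4}}"
| "inst (Suc (Suc (Suc m))) =
    (let k = Suc (Suc m); J = inst k
     in J \<union> shift (len J) J \<union> {{len J - k + 1..2 * len J + 1}})"

text \<open>The greedy rule does not say how to choose between hyperedges with the same maximum.
  It is therefore modelled as a relation: \<open>greedy_family E F\<close> holds iff some sequence of
  greedy choices from \<open>E\<close> leads to the (possibly still extendable) family \<open>F\<close>.\<close>

inductive greedy_family :: "nat set set \<Rightarrow> nat set set \<Rightarrow> bool" for E :: "nat set set" where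
  start: "greedy_family E {}"
| add: "greedy_family E F \<Longrightarrow> e \<in> E \<Longrightarrow> \<forall>f\<in>F. e \<inter> f = {} \<Longrightarrow>
    \<forall>e'\<in>E. (\<forall>f\<in>F. e' \<inter> f = {}) \<longrightarrow> Max e \<le> Max e' \<Longrightarrow>
    greedy_family E (insert e F)"

definition greedy_hitting_set :: "nat set set \<Rightarrow> nat set \<Rightarrow> bool" where
  "greedy_hitting_set E S \<longleftrightarrow>
    (\<exists>F. greedy_family E F \<and> \<not> (\<exists>e\<in>E. \<forall>f\<in>F. e \<inter> f = {}) \<and> S = Max ` F)"

text \<open>\<open>loop l V E c c'\<close>: started in round \<open>l\<close> with vertices \<open>V\<close>, hyperedges \<open>E\<close> and partial
  colouring \<open>c\<close>, the loop can terminate, the final colouring step producing \<open>c'\<close>.\<close>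

inductive loop ::
  "nat \<Rightarrow> nat set \<Rightarrow> nat set set \<Rightarrow> (nat \<rightharpoonup> nat) \<Rightarrow> (nat \<rightharpoonup> nat) \<Rightarrow> bool" where
  finish: "loop l V {} c (\<lambda>v. if v \<in> V then Some l else c v)"
| iterate: "E \<noteq> {} \<Longrightarrow> greedy_hitting_set E S \<Longrightarrow>
    loop (l + 1) S {e \<inter> S |e. e \<in> E \<and> card (e \<inter> S) > 1}
      (\<lambda>v. if v \<in> V - S then Some l else c v) c' \<Longrightarrow>
    loop l V E c c'"

definition algorithm_output :: "nat set \<Rightarrow> nat set set \<Rightarrow> (nat \<rightharpoonup> nat) \<Rightarrow> bool" where
  "algorithm_output V I c \<longleftrightarrow> loop 0 V I Map.empty c"

end

theory Submission
  imports Defs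
begin

text \<open>
  In a run on an instance every round shrinks the vertex set, and for the instance with index \<open>k\<close>
  it takes exactly \<open>k\<close> rounds to reach a single vertex without hyperedges. Hence every round uses its
  colour, and the colours are \<open>0, ..., k\<close>. That the run looks like this is shown by induction on
  \<open>k\<close>, following the doubling construction of the instances.

  Write \<open>J\<close> for the instance with index \<open>k\<close>, \<open>L\<close> for its length, and \<open>v = L - k + 1\<close> for the
  vertex at which the run on \<open>J\<close> ends. The next instance consists of two copies of \<open>J\<close> and a bridge,
  a hyperedge starting exactly at \<open>v\<close> and covering the whole second copy. During the first
  \<open>k\<close> rounds the vertex \<open>v\<close> and its translate \<open>v + L\<close> survive. So the bridge always keeps at
  least two vertices, and it is always hit at \<open>v\<close>, strictly before its own right end, so that it never
  influences a greedy choice. Both copies therefore evolve as \<open>J\<close> does on its own. After \<open>k\<close>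
  rounds the vertices \<open>v\<close> and \<open>v + L\<close> are left, and the bridge joins them; it costs one more
  round, which leaves \<open>v + L\<close>. This is the lemma \<open>peels_double\<close>.

  The ties in the greedy rule are harmless. In an interval hypergraph, any greedy hitting set \<open>S\<close> is a
  solution of a recursive description along the vertex order, \<open>right_ends\<close>: a vertex belongs to
  \<open>S\<close> iff it is the right end of a hyperedge that contains no earlier vertex of \<open>S\<close>. Such a recursion has at
  most one solution, so a candidate for \<open>S\<close> has to satisfy only this description, and no greedy
  sequence of choices has to be followed.
\<close>

section \<open>Greedy hitting sets of interval hypergraphs\<close>

text \<open>Whether \<open>x\<close> belongs to \<open>S\<close> depends on the part of \<open>S\<close> below \<open>x\<close> only.\<close>

definition right_ends :: "nat set set \<Rightarrow> nat set \<Rightarrow> bool" where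
  "right_ends E S \<longleftrightarrow> (\<forall>x. x \<in> S \<longleftrightarrow> (\<exists>e\<in>E. Max e = x \<and> e \<inter> S \<inter> {..<x} = {}))"

lemma right_ends_unique:
  assumes "right_ends E S" "right_ends E T"
  shows "S = T"
proof -
  have "x \<in> S \<longleftrightarrow> x \<in> T" for x
  proof (induction x rule: less_induct)
    case (less x)
    then have "e \<inter> S \<inter> {..<x} = e \<inter> T \<inter> {..<x}" for e by auto
    then show ?case using assms unfolding right_ends_def by metis
  qed
  then show ?thesis by blast
qed

text \<open>After the first round the hyperedges are traces of intervals on the surviving vertices. They
  need not be intervals of naturals any more, but they are intervals of the vertex set.\<close>

definition convex_in :: "nat set \<Rightarrow> nat set \<Rightarrow> bool" where
  "convex_in V e \<longleftrightarrow> e \<subseteq> V \<and> (\<forall>x\<in>e. \<forall>z\<in>e. \<forall>y\<in>V. x \<le> y \<longrightarrow> y \<le> z \<longrightarrow> y \<in> e)"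

lemma convex_in_between:
  "convex_in V e \<Longrightarrow> x \<in> e \<Longrightarrow> z \<in> e \<Longrightarrow> y \<in> V \<Longrightarrow> x \<le> y \<Longrightarrow> y \<le> z \<Longrightarrow> y \<in> e"
  unfolding convex_in_def by blast

lemma convex_in_Int:
  assumes "convex_in V e" "S \<subseteq> V"
  shows "convex_in S (e \<inter> S)"
  unfolding convex_in_def
proof (intro conjI ballI impI)
  fix x y z
  assume x: "x \<in> e \<inter> S" and z: "z \<in> e \<inter> S" and y: "y \<in> S" and le: "x \<le> y" "y \<le> z"
  have "y \<in> V" using y assms(2) by (rule subsetD[rotated])
  then have "y \<in> e" using convex_in_between[OF assms(1) IntD1[OF x] IntD1[OF z]] le by simp
  then show "y \<in> e \<inter> S" using y by (rule IntI)
qed simp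

definition interval_hypergraph :: "nat set \<Rightarrow> nat set set \<Rightarrow> bool" where
  "interval_hypergraph V E \<longleftrightarrow> finite E \<and> (\<forall>e\<in>E. finite e \<and> e \<noteq> {} \<and> convex_in V e)"

lemma greedy_family_subset: "greedy_family E F \<Longrightarrow> F \<subseteq> E"
  by (induction rule: greedy_family.induct) auto

lemma greedy_family_disjoint: "greedy_family E F \<Longrightarrow> pairwise disjnt F"
  by (induction rule: greedy_family.induct) (auto simp: pairwise_insert disjnt_def)

text \<open>Consider the first member of the family that meets \<open>e\<close>. When it was chosen, \<open>e\<close> was itself a
  candidate, so the chosen hyperedge does not end later than \<open>e\<close>.\<close>

lemma greedy_family_hits_early:
  assumes "greedy_family E F" "e \<in> E" "\<exists>f\<in>F. e \<inter> f \<noteq> {}"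
  shows "\<exists>f\<in>F. e \<inter> f \<noteq> {} \<and> Max f \<le> Max e"
  using assms
proof (induction rule: greedy_family.induct)
  case start
  then show ?case by simp
next
  case (add F e')
  show ?case
  proof (cases "\<exists>f\<in>F. e \<inter> f \<noteq> {}")
    case True
    then show ?thesis using add by auto
  next
    case False
    then show ?thesis using add by auto
  qed
qed

text \<open>The members of a greedy family are pairwise disjoint, so each contains no right end but its own.
  Conversely, a hyperedge \<open>e\<close> is met by a member that ends no later than \<open>e\<close>, and by convexity the
  end of that member lies in \<open>e\<close>. If \<open>e\<close> contains no selected vertex before its own right end, that
  right end must be the selected one.\<close>

lemma greedy_hitting_set_right_ends:
  assumes "greedy_hitting_set E S" "interval_hypergraph V E"
  shows "right_ends E S"
proof -
  obtain F where F: "greedy_family E F" and full: "\<not> (\<exists>e\<in>E. \<forall>f\<in>F. e \<inter> f = {})"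
    and S: "S = Max ` F"
    using assms(1) unfolding greedy_hitting_set_def by blast
  have sub: "F \<subseteq> E" using greedy_family_subset[OF F] .
  have disj: "e \<inter> f = {}" if "e \<in> F" "f \<in> F" "e \<noteq> f" for e f
    using greedy_family_disjoint[OF F] that by (auto simp: pairwise_def disjnt_def)
  have E: "finite e" "e \<noteq> {}" "convex_in V e"
    if "e \<in> E" for e
    using assms(2) that unfolding interval_hypergraph_def by simp_all
  have MaxE: "Max e \<in> e" if "e \<in> E" for e
    using E(1,2)[OF that] by simp
  have "x \<in> S \<longleftrightarrow> (\<exists>e\<in>E. Max e = x \<and> e \<inter> S \<inter> {..<x} = {})" for x
  proof
    assume "x \<in> S"
    then obtain f where f: "f \<in> F" "x = Max f" using S by blast
    have "Max g \<notin> f" if "g \<in> F" "Max g < x" for g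
    proof -
      have "g \<noteq> f" using that f by auto
      then show ?thesis using disj[OF that(1) f(1)] MaxE[of g] that(1) sub by blast
    qed
    then have "f \<inter> S \<inter> {..<x} = {}" using S by auto
    then show "\<exists>e\<in>E. Max e = x \<and> e \<inter> S \<inter> {..<x} = {}" using f sub by blast
  next
    assume "\<exists>e\<in>E. Max e = x \<and> e \<inter> S \<inter> {..<x} = {}"
    then obtain e where e: "e \<in> E" "Max e = x" "e \<inter> S \<inter> {..<x} = {}" by blast
    obtain f where f: "f \<in> F" "e \<inter> f \<noteq> {}" "Max f \<le> Max e"
      using greedy_family_hits_early[OF F e(1)] full e(1) by meson
    obtain z where z: "z \<in> e" "z \<in> f" using f(2) by blast
    have fE: "f \<in> E" using f(1) sub by blast
    have "Max f \<in> V" using MaxE[OF fE] E(3)[OF fE] unfolding convex_in_def by blast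
    moreover have "z \<le> Max f" using E(1)[OF fE] z(2) by simp
    ultimately have "Max f \<in> e" using convex_in_between[OF E(3)[OF e(1)] z(1) MaxE[OF e(1)]] f(3) by blast
    moreover have "Max f \<in> S" using f(1) S by blast
    ultimately have "Max f = x" using e(2,3) f(3) by fastforce
    then show "x \<in> S" using \<open>Max f \<in> S\<close> by simp
  qed
  then show ?thesis unfolding right_ends_def by blast
qed

text \<open>A family that is maximal among the greedy ones hits everything: otherwise the unhit hyperedge
  with the smallest right end could be added.\<close>

lemma greedy_hitting_set_exists:
  assumes "finite E" "{} \<notin> E"
  shows "\<exists>S. greedy_hitting_set E S"
proof -
  have "finite (Collect (greedy_family E))"
    by (rule finite_subset[of _ "Pow E"]) (use greedy_family_subset assms(1) in auto)
  moreover have "{} \<in> Collect (greedy_family E)" by (simp add: greedy_family.start)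
  ultimately obtain F where "F \<in> Collect (greedy_family E)"
    and max: "\<forall>G\<in>Collect (greedy_family E). F \<subseteq> G \<longrightarrow> F = G"
    by (meson finite_has_maximal2)
  then have F: "greedy_family E F" by simp
  have maximal: "F = G" if "greedy_family E G" "F \<subseteq> G" for G
    using max that by simp
  have "\<not> (\<exists>e\<in>E. \<forall>f\<in>F. e \<inter> f = {})"
  proof
    let ?A = "{e \<in> E. \<forall>f\<in>F. e \<inter> f = {}}"
    assume "\<exists>e\<in>E. \<forall>f\<in>F. e \<inter> f = {}"
    then have ne: "?A \<noteq> {}" by blast
    define e where "e = arg_min_on Max ?A"
    have e: "e \<in> ?A" and least: "\<And>e'. e' \<in> ?A \<Longrightarrow> Max e \<le> Max e'"
      unfolding e_def using arg_min_if_finite(1)[of ?A Max] arg_min_least[of ?A _ Max] ne assms(1)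
      by auto
    have "greedy_family E (insert e F)"
      by (rule greedy_family.add[OF F]) (use e least in auto)
    then have "e \<in> F" using maximal by blast
    then show False using e assms(2) by auto
  qed
  then show ?thesis using F unfolding greedy_hitting_set_def by blast
qed

section \<open>Runs that end in a single vertex\<close>

abbreviation restrict_edges :: "nat set set \<Rightarrow> nat set \<Rightarrow> nat set set" where
  "restrict_edges E S \<equiv> {e \<inter> S |e. e \<in> E \<and> card (e \<inter> S) > 1}"

lemma interval_hypergraph_restrict:
  assumes "interval_hypergraph V E" "S \<subseteq> V"
  shows "interval_hypergraph S (restrict_edges E S)"
proof -
  have "finite (restrict_edges E S)"
    by (rule finite_subset[of _ "(\<lambda>e. e \<inter> S) ` E"])
      (use assms(1) in \<open>auto simp: interval_hypergraph_def\<close>)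
  moreover have "finite e \<and> e \<noteq> {} \<and> convex_in S e"
    if e: "e \<in> restrict_edges E S" for e
  proof -
    obtain d where d: "e = d \<inter> S" "d \<in> E" "card e > 1" using e by blast
    have "finite e" "e \<noteq> {}" using d(3) card.infinite card.empty by fastforce+
    moreover have "convex_in S e"
      unfolding d(1)
      by (rule convex_in_Int[OF _ assms(2)]) (use assms(1) d(2) in \<open>auto simp: interval_hypergraph_def\<close>)
    ultimately show ?thesis by blast
  qed
  ultimately show ?thesis unfolding interval_hypergraph_def by blast
qed

text \<open>\<open>peels v n V E\<close> records the shape of a run that ends at \<open>v\<close> after \<open>n\<close> rounds. The
  proper inclusion in each round makes the round use its colour. Every intermediate vertex set has
  to contain \<open>v\<close>, because the bridge of the next instance has to be hit at \<open>v\<close> in all of these rounds.\<close>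

inductive peels :: "nat \<Rightarrow> nat \<Rightarrow> nat set \<Rightarrow> nat set set \<Rightarrow> bool" for v where
  single: "peels v 0 {v} {}"
| round: "E \<noteq> {} \<Longrightarrow> right_ends E S \<Longrightarrow> v \<in> S \<Longrightarrow> S \<subset> V \<Longrightarrow>
    peels v n S (restrict_edges E S) \<Longrightarrow> peels v (Suc n) V E"

lemma greedy_hitting_set_iff_right_ends:
  assumes "interval_hypergraph V E" "right_ends E S"
  shows "greedy_hitting_set E T \<longleftrightarrow> T = S"
proof -
  have only: "U = S" if "greedy_hitting_set E U" for U
    by (rule right_ends_unique[OF greedy_hitting_set_right_ends[OF that assms(1)] assms(2)])
  have "finite E" using assms(1) unfolding interval_hypergraph_def by (rule conjunct1)
  moreover have "{} \<notin> E"
    using assms(1) unfolding interval_hypergraph_def by blast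
  ultimately obtain U where U: "greedy_hitting_set E U" using greedy_hitting_set_exists by blast
  show ?thesis
  proof
    show "T = S" if "greedy_hitting_set E T" using only[OF that] .
    show "greedy_hitting_set E T" if "T = S" using U only[OF U] that by simp
  qed
qed

lemma peels_loop_terminates:
  assumes "peels v n V E" "interval_hypergraph V E"
  shows "\<exists>c'. loop l V E c c'"
  using assms
proof (induction arbitrary: l c rule: peels.induct)
  case (single l c)
  show ?case using loop.finish by blast
next
  case (round E S V n l c)
  have greedy: "greedy_hitting_set E S"
    using greedy_hitting_set_iff_right_ends[OF round.prems round.hyps(2)] by simp
  have "interval_hypergraph S (restrict_edges E S)"
    using interval_hypergraph_restrict[OF round.prems] round.hyps(4) by simp
  from round.IH[OF this] obtain c' where
    "loop (l + 1) S (restrict_edges E S) (\<lambda>v. if v \<in> V - S then Some l else c v) c'" ..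
  from loop.iterate[OF round.hyps(1) greedy this] show ?case by (rule exI[of _ c'])
qed

lemma ran_colour_new:
  assumes "A \<noteq> {}" "dom c \<inter> A = {}"
  shows "ran (\<lambda>u. if u \<in> A then Some l else c u) = insert l (ran c)"
proof
  show "ran (\<lambda>u. if u \<in> A then Some l else c u) \<subseteq> insert l (ran c)"
    by (auto simp: ran_def split: if_splits)
  show "insert l (ran c) \<subseteq> ran (\<lambda>u. if u \<in> A then Some l else c u)"
  proof
    fix x
    assume "x \<in> insert l (ran c)"
    then consider "x = l" | u where "c u = Some x" unfolding ran_def by blast
    then show "x \<in> ran (\<lambda>u. if u \<in> A then Some l else c u)"
    proof cases
      case 1
      obtain u where "u \<in> A" using assms(1) by blast
      then show ?thesis using 1 by (intro ranI[of _ u]) simp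
    next
      case 2
      then have "u \<notin> A" using assms(2) by blast
      then show ?thesis using 2 by (intro ranI[of _ u]) simp
    qed
  qed
qed

text \<open>Each round colours the nonempty set of removed vertices, which had no colour before, so no
  colour is overwritten.\<close>

lemma peels_loop_colours:
  assumes "peels v n V E" "interval_hypergraph V E" "loop l V E c c'" "dom c \<inter> V = {}"
  shows "ran c' = ran c \<union> {l..l + n}"
  using assms
proof (induction arbitrary: l c rule: peels.induct)
  case (single l c)
  have "c' = (\<lambda>u. if u \<in> {v} then Some l else c u)"
    using single.prems(2) by (cases rule: loop.cases) auto
  then show ?case using ran_colour_new[of "{v}" c l] single.prems(3) by simp
next
  case (round E S V n l c)
  let ?c = "\<lambda>u. if u \<in> V - S then Some l else c u"
  from round.prems(2) have loop: "loop (l + 1) S (restrict_edges E S) ?c c'"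
  proof (cases rule: loop.cases)
    case finish
    then show ?thesis using round.hyps(1) by simp
  next
    case (iterate T)
    then have "T = S"
      using greedy_hitting_set_iff_right_ends[OF round.prems(1) round.hyps(2)] by simp
    then show ?thesis using iterate(3) by simp
  qed
  have "V - S \<noteq> {}" "dom c \<inter> (V - S) = {}" using round.prems(3) round.hyps(4) by auto
  then have "ran ?c = insert l (ran c)" by (rule ran_colour_new)
  moreover have "ran c' = ran ?c \<union> {l + 1..l + 1 + n}"
  proof (rule round.IH[OF _ loop])
    show "interval_hypergraph S (restrict_edges E S)"
      using interval_hypergraph_restrict[OF round.prems(1)] round.hyps(4) by simp
    show "dom ?c \<inter> S = {}"
    proof -
      have "dom ?c \<subseteq> dom c \<union> (V - S)" by (auto split: if_splits)
      then show ?thesis using round.prems(3) round.hyps(4) by blast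
    qed
  qed
  moreover have "{l..l + Suc n} = insert l {l + 1..l + 1 + n}"
    using atLeastAtMost_insertL[of l "l + Suc n"] by simp
  ultimately show ?case by simp
qed

section \<open>Two copies joined by a bridge\<close>

text \<open>The bridge \<open>b\<close> contains the selected vertex \<open>v\<close> and ends at \<open>v + L\<close> or later, hence it is
  never the reason for a selection. The two copies live on disjoint ranges and do not interact.\<close>

lemma right_ends_double:
  assumes S: "right_ends E S" and E: "\<And>e. e \<in> E \<Longrightarrow> e \<noteq> {} \<and> e \<subseteq> {1..L}"
    and b: "finite b" "v \<in> S" "v \<in> b" "v + L \<in> b" "L > 0"
  shows "right_ends (E \<union> (`) (\<lambda>x. x + L) ` E \<union> {b}) (S \<union> (\<lambda>x. x + L) ` S)"
proof -
  let ?sh = "\<lambda>x::nat. x + L"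
  have fin: "finite e" if "e \<in> E" for e using E[OF that] finite_subset by blast
  have MaxE: "Max e \<in> e" "Max (?sh ` e) = Max e + L" if "e \<in> E" for e
    using E[OF that] fin[OF that] by (auto simp: Max_add_commute)
  have S_iff: "x \<in> S \<longleftrightarrow> (\<exists>e\<in>E. Max e = x \<and> e \<inter> S \<inter> {..<x} = {})" for x
    using S unfolding right_ends_def by blast
  have SL: "S \<subseteq> {1..L}"
  proof
    fix x
    assume "x \<in> S"
    then obtain e where "e \<in> E" "Max e = x" using S_iff by blast
    then show "x \<in> {1..L}" using MaxE(1)[of e] E[of e] by blast
  qed
  let ?S = "S \<union> ?sh ` S"
  have left: "e \<inter> ?S = e \<inter> S" if "e \<in> E" for e
    using E[OF that] SL by fastforce
  have right: "?sh ` e \<inter> ?S = ?sh ` (e \<inter> S)" if "e \<in> E" for e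
    using E[OF that] SL by fastforce
  have "x \<in> ?S \<longleftrightarrow> (\<exists>e\<in>E \<union> (`) ?sh ` E \<union> {b}. Max e = x \<and> e \<inter> ?S \<inter> {..<x} = {})" for x
  proof
    assume "x \<in> ?S"
    then consider "x \<in> S" | y where "y \<in> S" "x = y + L" by blast
    then show "\<exists>e\<in>E \<union> (`) ?sh ` E \<union> {b}. Max e = x \<and> e \<inter> ?S \<inter> {..<x} = {}"
    proof cases
      case 1
      then obtain e where "e \<in> E" "Max e = x" "e \<inter> S \<inter> {..<x} = {}" using S_iff by blast
      then show ?thesis using left by (intro bexI[of _ e]) auto
    next
      case 2
      then obtain e where e: "e \<in> E" "Max e = y" "e \<inter> S \<inter> {..<y} = {}" using S_iff by blast
      have "?sh ` e \<inter> ?S \<inter> {..<x} = {}" using e(3) 2(2) unfolding right[OF e(1)] by auto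
      then show ?thesis
        using e(1,2) 2(2) MaxE(2)[OF e(1)] by (intro bexI[of _ "?sh ` e"]) simp_all
    qed
  next
    assume "\<exists>e\<in>E \<union> (`) ?sh ` E \<union> {b}. Max e = x \<and> e \<inter> ?S \<inter> {..<x} = {}"
    then obtain d where "d \<in> E \<union> (`) ?sh ` E \<union> {b}" and d: "Max d = x" "d \<inter> ?S \<inter> {..<x} = {}"
      by meson
    then consider "d \<in> E" | e where "e \<in> E" "d = ?sh ` e" | "d = b" by blast
    then show "x \<in> ?S"
    proof cases
      case 1
      then have "d \<inter> S \<inter> {..<x} = {}" using d(2) left by simp
      then have "x \<in> S" using S_iff 1 d(1) by blast
      then show ?thesis by simp
    next
      case (2 e)
      then have x: "x = Max e + L" using d(1) MaxE(2) by simp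
      have "?sh ` (e \<inter> S) \<inter> {..<x} = {}" using d(2) right[OF 2(1)] 2(2) by simp
      then have "e \<inter> S \<inter> {..<Max e} = {}" unfolding x by auto
      then have "Max e \<in> S" using S_iff 2(1) by blast
      then show ?thesis using x by simp
    next
      case 3
      have "v + L \<le> x" using Max_ge[OF b(1,4)] 3 d(1) by simp
      then have "v \<in> d \<inter> ?S \<inter> {..<x}" using b 3 by simp
      then show ?thesis using d(2) by simp
    qed
  qed
  then show ?thesis unfolding right_ends_def by blast
qed

text \<open>The shape of two copies and a bridge is preserved by a round: the bridge survives, since it keeps
  both \<open>v\<close> and \<open>v + L\<close>.\<close>

lemma restrict_edges_double:
  assumes E: "\<And>e. e \<in> E \<Longrightarrow> e \<subseteq> {1..L}" and S: "S \<subseteq> {1..L}"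
    and b: "finite b" "v \<in> S" "v \<in> b" "v + L \<in> b" "L > 0"
  shows "restrict_edges (E \<union> (`) (\<lambda>x. x + L) ` E \<union> {b}) (S \<union> (\<lambda>x. x + L) ` S)
    = restrict_edges E S \<union> (`) (\<lambda>x. x + L) ` restrict_edges E S \<union> {b \<inter> (S \<union> (\<lambda>x. x + L) ` S)}"
proof -
  let ?sh = "\<lambda>x::nat. x + L"
  let ?S = "S \<union> ?sh ` S"
  have left: "e \<inter> ?S = e \<inter> S" if "e \<in> E" for e
    using E[OF that] S by fastforce
  have right: "?sh ` e \<inter> ?S = ?sh ` (e \<inter> S)" if "e \<in> E" for e
    using E[OF that] S by fastforce
  have card: "card (?sh ` e) = card e" for e by (simp add: card_image)
  have "{v, v + L} \<subseteq> b \<inter> ?S" using b by auto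
  then have "card {v, v + L} \<le> card (b \<inter> ?S)" by (intro card_mono) (use b(1) in auto)
  then have big: "card (b \<inter> ?S) > 1" using b(5) by simp
  show ?thesis (is "?lhs = ?rhs")
  proof
    show "?lhs \<subseteq> ?rhs"
    proof
      fix d
      assume "d \<in> ?lhs"
      then obtain e where d: "d = e \<inter> ?S" "card d > 1" and "e \<in> E \<union> (`) ?sh ` E \<union> {b}"
        by blast
      then consider "e \<in> E" | e' where "e' \<in> E" "e = ?sh ` e'" | "e = b" by blast
      then show "d \<in> ?rhs"
      proof cases
        case 1
        then have "d \<in> restrict_edges E S" using d left by auto
        then show ?thesis by blast
      next
        case 2
        then have "d = ?sh ` (e' \<inter> S)" using d right by simp
        moreover have "e' \<inter> S \<in> restrict_edges E S" using 2 d(2) calculation card by auto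
        ultimately show ?thesis by blast
      next
        case 3
        then show ?thesis using d by blast
      qed
    qed
    show "?rhs \<subseteq> ?lhs"
    proof
      fix d
      assume "d \<in> ?rhs"
      then consider e where "e \<in> E" "card (e \<inter> S) > 1" "d = e \<inter> S"
        | e where "e \<in> E" "card (e \<inter> S) > 1" "d = ?sh ` (e \<inter> S)"
        | "d = b \<inter> ?S" by blast
      then show "d \<in> ?lhs"
      proof cases
        case (1 e)
        then have "d = e \<inter> ?S \<and> e \<in> E \<union> (`) ?sh ` E \<union> {b} \<and> card (e \<inter> ?S) > 1"
          using left by simp
        then show ?thesis by blast
      next
        case (2 e)
        then have "d = ?sh ` e \<inter> ?S \<and> ?sh ` e \<in> E \<union> (`) ?sh ` E \<union> {b} \<and> card (?sh ` e \<inter> ?S) > 1"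
          using right card by simp
        then show ?thesis by blast
      next
        case 3
        then show ?thesis using big by blast
      qed
    qed
  qed
qed

text \<open>The extra vertices \<open>W\<close> make room for the right end \<open>2 * L + 1\<close> of the bridge of an instance,
  which lies beyond both copies. Only vertices selected in one of the copies survive a round, so the
  induction hypothesis is used with \<open>W\<close> empty. For \<open>n = 0\<close> no earlier round could remove \<open>W\<close>, hence the last
  hypothesis: the remaining round has to select \<open>v + L\<close>, which must be the right end of the bridge.\<close>

lemma peels_double:
  assumes "peels v n V E" and "V \<subseteq> {1..L}" "\<And>e. e \<in> E \<Longrightarrow> e \<noteq> {} \<and> e \<subseteq> {1..L}"
    and "finite b" "v \<in> b" "v + L \<in> b" "b \<subseteq> V \<union> (\<lambda>x. x + L) ` V \<union> W" "n = 0 \<Longrightarrow> W = {}"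
  shows "peels (v + L) (Suc n) (V \<union> (\<lambda>x. x + L) ` V \<union> W) (E \<union> (`) (\<lambda>x. x + L) ` E \<union> {b})"
  using assms
proof (induction arbitrary: b W rule: peels.induct)
  case (single b W)
  have L: "L > 0" using single.prems(1) by auto
  have W: "W = {}" using single.prems(7) by simp
  have b: "b = {v, v + L}" using single.prems(4-6) W by auto
  have "Max b = v + L" using b by simp
  then have ends: "right_ends {b} {v + L}" unfolding right_ends_def by auto
  have "restrict_edges {b} {v + L} = {}" using b L by auto
  then have last: "peels (v + L) 0 {v + L} (restrict_edges {b} {v + L})"
    using peels.single[of "v + L"] by simp
  have sub: "{v + L} \<subset> {v, v + L}" using L by (simp add: psubset_eq set_eq_iff exI[of _ v])
  have "peels (v + L) (Suc 0) {v, v + L} {b}"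
    by (rule peels.round[OF insert_not_empty ends singletonI sub last])
  then show ?case using W by (simp add: insert_commute)
next
  case (round E S V n b W)
  let ?sh = "\<lambda>x::nat. x + L"
  let ?S = "S \<union> ?sh ` S"
  have L: "L > 0" using round.prems(1) round.hyps(3,4) by auto
  have SL: "S \<subseteq> {1..L}" using round.prems(1) round.hyps(4) by blast
  obtain u where u: "u \<in> V" "u \<notin> S" using round.hyps(4) by blast
  have "u \<notin> ?sh ` S" using SL round.prems(1) u(1) by fastforce
  then have sub: "?S \<subset> V \<union> ?sh ` V \<union> W" using u round.hyps(4) by blast
  have "peels (v + L) (Suc n) (?S \<union> {})
    (restrict_edges E S \<union> (`) ?sh ` restrict_edges E S \<union> {b \<inter> ?S})"
  proof (rule round.IH)
    show "S \<subseteq> {1..L}" by fact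
    show "e \<noteq> {} \<and> e \<subseteq> {1..L}" if "e \<in> restrict_edges E S" for e
      using that SL by fastforce
  qed (use round.prems round.hyps in auto)
  also have "restrict_edges E S \<union> (`) ?sh ` restrict_edges E S \<union> {b \<inter> ?S}
      = restrict_edges (E \<union> (`) ?sh ` E \<union> {b}) ?S"
    by (rule restrict_edges_double[symmetric]) (use round.prems round.hyps SL L in auto)
  finally have rest: "peels (v + L) (Suc n) ?S (restrict_edges (E \<union> (`) ?sh ` E \<union> {b}) ?S)" by simp
  have ends: "right_ends (E \<union> (`) ?sh ` E \<union> {b}) ?S"
    by (rule right_ends_double[where v = v]) (use round.prems round.hyps L in auto)
  have "E \<union> (`) ?sh ` E \<union> {b} \<noteq> {}" "v + L \<in> ?S" using round.hyps(3) by simp_all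
  then show ?case by (rule peels.round[OF _ ends _ sub rest])
qed

section \<open>The recursively defined instances\<close>

lemma shift_eq_image:
  assumes "\<And>e. e \<in> I \<Longrightarrow> \<exists>i j. i \<le> j \<and> e = {i..j}"
  shows "shift d I = (`) (\<lambda>x. x + d) ` I"
proof
  show "shift d I \<subseteq> (`) (\<lambda>x. x + d) ` I"
  proof
    fix e
    assume "e \<in> shift d I"
    then obtain i j where e: "e = {i + d..j + d}" "{i..j} \<in> I" unfolding shift_def by blast
    show "e \<in> (`) (\<lambda>x. x + d) ` I"
      by (rule image_eqI[OF _ e(2)]) (simp add: e(1) image_add_atLeastAtMost')
  qed
  show "(`) (\<lambda>x. x + d) ` I \<subseteq> shift d I"
  proof
    fix e
    assume "e \<in> (`) (\<lambda>x. x + d) ` I"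
    then obtain e' where e': "e' \<in> I" "e = (\<lambda>x. x + d) ` e'" by blast
    then obtain i j where "i \<le> j" "e' = {i..j}" using assms by blast
    then have "e = {i + d..j + d} \<and> i \<le> j \<and> {i..j} \<in> I"
      using e' by (simp add: image_add_atLeastAtMost')
    then show "e \<in> shift d I" unfolding shift_def by blast
  qed
qed

lemma len_if_Union: "\<Union>I = {1..n} \<Longrightarrow> n \<ge> 1 \<Longrightarrow> len I = n"
  using Max_eq_iff[of "{1..n}" n] Min_eq_iff[of "{1..n}" 1] by (simp add: len_def)

lemma peels_inst_2: "peels 3 2 {1..4} (inst 2)"
proof -
  have I: "inst 2 = {{1..2}, {3..3}, {2..4}}" by (simp add: numeral_2_eq_2)
  have Ex: "(\<exists>e\<in>{a, b, c}. P e) \<longleftrightarrow> P a \<or> P b \<or> P c" for a b c :: "nat set" and P by blast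
  have e: "{1..2} = {1, 2::nat}" "{2..4} = {2, 3, 4::nat}" by auto
  have first: "right_ends (inst 2) {2, 3}"
  proof -
    have "Max {1, 2::nat} = 2" "Max {2, 3, 4::nat} = 4" by simp_all
    then show ?thesis unfolding right_ends_def I Ex e by (auto simp del: Max_insert)
  qed
  have "restrict_edges (inst 2) {2, 3} = (\<lambda>e. e \<inter> {2, 3}) ` {e \<in> inst 2. card (e \<inter> {2, 3}) > 1}"
    by blast
  also have "{e \<in> inst 2. card (e \<inter> {2, 3}) > 1} = {{2, 3, 4}}"
    unfolding I e by auto
  also have "(\<lambda>e. e \<inter> {2, 3}) ` {{2, 3, 4}} = {{2, 3::nat}}" by auto
  finally have trace: "restrict_edges (inst 2) {2, 3} = {{2, 3}}" .
  have second: "right_ends {{2, 3}} {3}" unfolding right_ends_def by auto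
  have "restrict_edges {{2, 3}} {3} = {}" by auto
  then have third: "peels 3 0 {3} (restrict_edges {{2, 3}} {3})" using peels.single[of 3] by simp
  have "{3} \<subset> {2, 3::nat}" by (simp add: psubset_eq)
  from peels.round[OF insert_not_empty second singletonI this third]
  have rest: "peels 3 1 {2, 3} (restrict_edges (inst 2) {2, 3})" unfolding trace by simp
  have sub: "{2, 3} \<subset> {1..4::nat}" by (simp add: psubset_eq set_eq_iff exI[of _ 1])
  have "inst 2 \<noteq> {}" unfolding I by simp
  from peels.round[OF this first _ sub rest] have "peels 3 (Suc 1) {1..4} (inst 2)" by simp
  then show ?thesis by (simp add: numeral_2_eq_2)
qed

text \<open>The lower bound on the length keeps \<open>len (inst k) - k\<close> from being truncated. The final vertices
  fit together: if \<open>L\<close> is the length of the instance with index \<open>k\<close>, then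
  \<open>(L - k + 1) + L = (2 * L + 1) - (k + 1) + 1\<close>.\<close>

lemma inst_properties:
  assumes "k \<ge> 2"
  shows "finite (inst k) \<and> (\<forall>e\<in>inst k. \<exists>i j. i \<le> j \<and> e = {i..j}) \<and>
    \<Union>(inst k) = {1..len (inst k)} \<and> 2 * k \<le> len (inst k) \<and>
    peels (len (inst k) - k + 1) k {1..len (inst k)} (inst k)"
  using assms
proof (induction k rule: nat_induct_at_least)
  case base
  have I: "inst 2 = {{1..2}, {3..3}, {2..4}}" by (simp add: numeral_2_eq_2)
  have U: "\<Union>(inst 2) = {1..4}" unfolding I by auto
  have len: "len (inst 2) = 4" using len_if_Union[OF U] by simp
  have "\<forall>e\<in>inst 2. \<exists>i j. i \<le> j \<and> e = {i..j}"
    unfolding I by fastforce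
  moreover have "finite (inst 2)" unfolding I by simp
  ultimately show ?case using U peels_inst_2 unfolding len by simp
next
  case (Suc k)
  let ?J = "inst k"
  let ?L = "len ?J"
  let ?sh = "\<lambda>x::nat. x + ?L"
  let ?b = "{?L - k + 1..2 * ?L + 1}"
  have fin: "finite ?J" and ivl: "\<And>e. e \<in> ?J \<Longrightarrow> \<exists>i j. i \<le> j \<and> e = {i..j}"
    and U: "\<Union>?J = {1..?L}" and L: "2 * k \<le> ?L"
    and peel: "peels (?L - k + 1) k {1..?L} ?J"
    using Suc.IH by blast+
  obtain m where m: "k = Suc (Suc m)" using Suc.hyps by (metis add_2_eq_Suc le_Suc_ex)
  have I: "inst (Suc k) = ?J \<union> (`) ?sh ` ?J \<union> {?b}"
    using shift_eq_image[of ?J ?L] ivl unfolding m by (simp add: Let_def)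
  have sh: "?sh ` {1..?L} = {?L + 1..2 * ?L}"
    by (simp add: image_add_atLeastAtMost' mult_2)
  have "\<Union>(inst (Suc k)) = \<Union>?J \<union> ?sh ` (\<Union>?J) \<union> ?b" unfolding I by blast
  also have "\<dots> = {1..2 * ?L + 1}" unfolding U sh using L Suc.hyps by auto
  finally have U': "\<Union>(inst (Suc k)) = {1..2 * ?L + 1}" .
  have len: "len (inst (Suc k)) = 2 * ?L + 1" using len_if_Union[OF U'] by simp
  have ivl': "\<exists>i j. i \<le> j \<and> e = {i..j}" if e: "e \<in> inst (Suc k)" for e
  proof -
    consider "e \<in> ?J" | d where "d \<in> ?J" "e = ?sh ` d" | "e = ?b"
      using e unfolding I by (elim UnE imageE singletonE) simp_all
    then show ?thesis
    proof cases
      case 1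
      then show ?thesis using ivl by blast
    next
      case 2
      then obtain i j where "i \<le> j" "d = {i..j}" using ivl by blast
      then have "i + ?L \<le> j + ?L \<and> e = {i + ?L..j + ?L}"
        using 2 by (simp add: image_add_atLeastAtMost')
      then show ?thesis by blast
    next
      case 3
      have "?L - k + 1 \<le> 2 * ?L + 1" by simp
      then show ?thesis using 3 by blast
    qed
  qed
  have "peels (?L - k + 1 + ?L) (Suc k) ({1..?L} \<union> ?sh ` {1..?L} \<union> {2 * ?L + 1}) (inst (Suc k))"
    unfolding I
  proof (rule peels_double[OF peel])
    show "e \<noteq> {} \<and> e \<subseteq> {1..?L}" if "e \<in> ?J" for e
      using ivl[OF that] U that by fastforce
    show "?b \<subseteq> {1..?L} \<union> ?sh ` {1..?L} \<union> {2 * ?L + 1}" unfolding sh by auto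
  qed (use Suc.hyps L in auto)
  also have "{1..?L} \<union> ?sh ` {1..?L} \<union> {2 * ?L + 1} = {1..len (inst (Suc k))}"
    unfolding sh len by auto
  also have "?L - k + 1 + ?L = len (inst (Suc k)) - Suc k + 1" using L len by simp
  finally have "peels (len (inst (Suc k)) - Suc k + 1) (Suc k) {1..len (inst (Suc k))} (inst (Suc k))" .
  moreover have "2 * Suc k \<le> len (inst (Suc k))" using L len Suc.hyps by simp
  moreover have "finite (inst (Suc k))" unfolding I using fin by simp
  ultimately show ?case using U' len ivl' by simp
qed

theorem proposition4p10:
  fixes k :: nat
  assumes "k \<ge> 2"
  shows "(\<exists>c. algorithm_output {1..len (inst k)} (inst k) c) \<and>
    (\<forall>c. algorithm_output {1..len (inst k)} (inst k) c \<longrightarrow> {a \<in> ran c. a > 0} = {1..k})"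
proof -
  let ?I = "inst k" and ?V = "{1..len (inst k)}"
  have fin: "finite ?I" and ivl: "\<And>e. e \<in> ?I \<Longrightarrow> \<exists>i j. i \<le> j \<and> e = {i..j}"
    and U: "\<Union>?I = ?V" and peel: "peels (len ?I - k + 1) k ?V ?I"
    using inst_properties[OF assms] by blast+
  have "finite e \<and> e \<noteq> {} \<and> convex_in ?V e" if e: "e \<in> ?I" for e
  proof -
    obtain i j where "i \<le> j" "e = {i..j}" using ivl[OF e] by blast
    moreover have "e \<subseteq> ?V" using U e by blast
    ultimately show ?thesis by (simp add: convex_in_def)
  qed
  then have H: "interval_hypergraph ?V ?I" using fin by (simp add: interval_hypergraph_def)
  show ?thesis
  proof (intro conjI allI impI)
    show "\<exists>c. algorithm_output ?V ?I c"
      unfolding algorithm_output_def by (rule peels_loop_terminates[OF peel H])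
  next
    fix c
    assume "algorithm_output ?V ?I c"
    then have "loop 0 ?V ?I Map.empty c" unfolding algorithm_output_def .
    from peels_loop_colours[OF peel H this] have "ran c = {0..k}" by simp
    then have "a \<in> {a \<in> ran c. a > 0} \<longleftrightarrow> a \<in> {1..k}" for a by (simp, linarith)
    then show "{a \<in> ran c. a > 0} = {1..k}" by (rule set_eqI)
  qed
qed

end
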